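(* Let $m\ge1$, $n=2m$, and let $L(x)=\sum_{i=0}^k\alpha_ix^{2^{a_i}}\in \mathbb{F}_{2^m}[x]$ be a linearized polynomial with coefficients $\alpha_i\in\mathbb{F}_{2^m}$ and nonnegative integers $a_i$. Define $$r(L)=\sum_{a\in \mathbb{F}_{2^n}}\chi_n\big((a^{2^m}+a)L(a)\big).$$ Then $$r(L)=2^m\sum_{u\in \mathbb{F}_{2^m}}\chi_m(uL(u))=2^m\sum_{u\in \mathbb{F}_{2^m}}\chi_m\left(\sum_{i=0}^k\alpha_iu^{2^{a_i}+1}\right).$$
   Context: For a positive integer $t$, ${\rm Tr}_1^t(x)=\sum_{i=0}^{t-1}x^{2^i}$ is the absolute trace from $\mathbb{F}_{2^t}$ to $\mathbb{F}_2$ and $\chi_t(x)=(-1)^{{\rm Tr}_1^t(x)}$. $\mathbb{F}_{2^m}$ is regarded as the subfield of $\mathbb{F}_{2^n}$. *)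

theory Defs
  imports "HOL-Algebra.Algebraic_Closure_Type"
begin

(* The trace of F_(2^t), computed in any field that contains F_(2^t). Its values 0 and 1 are
   elements of that field. *)
definition abs_trace :: "nat \<Rightarrow> 'a::field \<Rightarrow> 'a" where
  "abs_trace t x = (\<Sum>i<t. x ^ (2 ^ i))"

lemma abs_trace_in_prime_field:
  fixes x :: "'a::field"
  assumes "CHAR('a) = 2" and "x ^ (2 ^ t) = x"
  shows "abs_trace t x \<in> {0, 1}"
proof -
  have "abs_trace t x ^ 2 = (\<Sum>i<t. (x ^ (2 ^ i)) ^ 2)"
    unfolding abs_trace_def
    by (rule freshmans_dream_sum) (simp_all only: assms(1) two_is_prime_nat)
  also have "\<dots> = (\<Sum>i<t. x ^ (2 ^ Suc i))"
    by (rule sum.cong) (simp_all only: power_Suc2 power_mult)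
  also have "\<dots> = abs_trace t x + (x ^ (2 ^ t) - x)"
    unfolding abs_trace_def by (induction t) simp_all
  finally have "abs_trace t x * (abs_trace t x - 1) = 0"
    using assms(2) by (simp add: power2_eq_square algebra_simps)
  then show ?thesis by auto
qed

(* (-1) raised to the trace: the inner conditional lifts the trace value from {0, 1} in the
   field to the natural numbers. Meaningful for x in F_(2^t), by the lemma above. *)
definition chi :: "nat \<Rightarrow> 'a::field \<Rightarrow> int" where
  "chi t x = (- 1) ^ (if abs_trace t x = 0 then 0 else 1)"

definition linearized_poly :: "nat \<Rightarrow> (nat \<Rightarrow> 'a::field) \<Rightarrow> (nat \<Rightarrow> nat) \<Rightarrow> 'a poly" where
  "linearized_poly k \<alpha> a = (\<Sum>i=0..k. Polynomial.monom (\<alpha> i) (2 ^ a i))"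

(* The ambient type 'a plays the role of F_(2^n) with n = 2 m. *)
definition r_sum :: "nat \<Rightarrow> 'a::field poly \<Rightarrow> int" where
  "r_sum m L = (\<Sum>a\<in>UNIV. chi (2 * m) ((a ^ (2 ^ m) + a) * poly L a))"

end

theory Submission
  imports Defs "HOL-Number_Theory.Residues"
begin

text \<open>Write q = 2^m and let T = rel_trace q d, so T(x) = x + x^q + ... + x^(q^(d-1)). The
  map T is linear over the fixed field F of x \<mapsto> x^q and, the coefficients of L lying in F,
  commutes with L. Hence T(T(x) L(x)) = T(x) L(T(x)), and transitivity of the trace turns the
  character of the big field at T(x) L(x) into the character of F at T(x) L(T(x)). The kernel of T
  has at most q^(d-1) elements and F has at most q, both being root sets of polynomials; as the
  whole field has q^d elements, T is onto F and takes every value exactly q^(d-1) times. The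
  theorem is the case d = 2.\<close>

lemma CHAR_eq_if_card_UNIV_eq_prime_power:
  assumes "prime p" and "card (UNIV :: 'a::field set) = p ^ n"
  shows "CHAR('a) = p"
proof -
  have "finite (UNIV :: 'a set)"
    using assms by (metis card.infinite power_not_zero not_prime_0)
  then have "prime CHAR('a)"
    by (intro prime_CHAR_semidom finite_imp_CHAR_pos)
  moreover have "CHAR('a) dvd p ^ n"
    using CHAR_dvd_CARD[where 'a = 'a] assms(2) by simp
  ultimately show ?thesis
    using assms(1) by (metis prime_dvd_power primes_dvd_imp_eq)
qed

lemma nat_pow_ring_of_type_algebra:
  "x [^]\<^bsub>ring_of_type_algebra\<^esub> (n :: nat) = x ^ n"
  by (induction n) (simp_all add: nat_pow_def ring_of_type_algebra_def flip: power_Suc2)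

lemma subfield_power_card_eq_self:
  fixes K :: "'a::field set"
  assumes "subfield K (ring_of_type_algebra :: 'a ring)" and "finite K" and "x \<in> K"
  shows "x ^ card K = x"
proof (cases "x = 0")
  case True
  with assms(2,3) show ?thesis by (auto simp: card_gt_0_iff)
next
  case False
  define R :: "'a ring" where "R = ring_of_type_algebra"
  have zero: "\<zero>\<^bsub>R\<^esub> = 0" and one: "\<one>\<^bsub>R\<^esub> = 1"
    by (simp_all add: R_def ring_of_type_algebra_def)
  interpret R: field R
    unfolding R_def by (rule field_from_type_algebra)
  interpret F: field "R\<lparr>carrier := K\<rparr>"
    using assms(1) unfolding R_def[symmetric] by (rule R.subfield_iff(2))
  have Units: "Units (R\<lparr>carrier := K\<rparr>) = K - {0}"
    using F.field_Units by (simp add: zero)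
  have "x [^]\<^bsub>R\<lparr>carrier := K\<rparr>\<^esub> card (K - {0}) = 1"
    using F.units_power_order_eq_one[of x] assms(2,3) False by (simp add: Units one)
  then have "x ^ card (K - {0}) = 1"
    unfolding R.nat_pow_consistent[symmetric] by (simp add: R_def nat_pow_ring_of_type_algebra)
  moreover have "card K = Suc (card (K - {0}))"
    using assms(2) F.zero_closed by (intro card.remove) (simp_all add: zero)
  ultimately show ?thesis by simp
qed

lemma power_card_UNIV_eq_self:
  fixes x :: "'a::field"
  assumes "finite (UNIV :: 'a set)"
  shows "x ^ card (UNIV :: 'a set) = x"
proof -
  let ?R = "ring_of_type_algebra :: 'a ring"
  have "subfield (carrier ?R) ?R"
    by (rule field.carrier_is_subfield[OF field_from_type_algebra])
  moreover have "carrier ?R = UNIV"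
    by (simp only: ring_of_type_algebra_def partial_object.simps)
  ultimately show ?thesis
    using assms by (simp add: subfield_power_card_eq_self)
qed

lemma
  assumes "q > 1"
  shows finite_power_eq_self: "finite {x :: 'a::idom. x ^ q = x}"
    and card_power_eq_self_le: "card {x :: 'a. x ^ q = x} \<le> q"
proof -
  define p :: "'a poly" where "p = Polynomial.monom 1 q - Polynomial.monom 1 1"
  have roots: "{x. poly p x = 0} = {x. x ^ q = x}"
    by (simp add: p_def poly_monom)
  have "poly.coeff p q = 1"
    using assms by (simp add: p_def)
  then have "p \<noteq> 0" by auto
  then show "finite {x :: 'a. x ^ q = x}"
    unfolding roots[symmetric] by (rule poly_roots_finite)
  have "card {x. poly p x = 0} \<le> degree p"
    using \<open>p \<noteq> 0\<close> by (rule card_poly_roots_bound)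
  also have "\<dots> \<le> q"
    unfolding p_def using assms by (intro degree_diff_le order.trans[OF degree_monom_le]) auto
  finally show "card {x :: 'a. x ^ q = x} \<le> q"
    by (simp only: roots)
qed

lemma subfield_eq_fixed_points_power_card:
  fixes K :: "'a::field set"
  assumes "subfield K (ring_of_type_algebra :: 'a ring)" and "finite K"
  shows "K = {x. x ^ card K = x}"
proof (rule card_seteq)
  have "{0, 1} \<subseteq> K"
    using subringE(2,3)[OF subfieldE(1)[OF assms(1)]] by (simp add: ring_of_type_algebra_def)
  then have "card {0, 1 :: 'a} \<le> card K"
    by (rule card_mono[OF assms(2)])
  then have "card K > 1"
    by simp
  then show "finite {x :: 'a. x ^ card K = x}" "card {x :: 'a. x ^ card K = x} \<le> card K"
    by (rule finite_power_eq_self card_power_eq_self_le)+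
  show "K \<subseteq> {x. x ^ card K = x}"
    using subfield_power_card_eq_self[OF assms] by auto
qed

lemma (in additive) sum_comp_eq_card_kernel_mult_sum_range:
  fixes g :: "'b \<Rightarrow> 'c::comm_semiring_1"
  assumes "finite (UNIV :: 'a set)"
  shows "(\<Sum>x\<in>UNIV. g (f x)) = of_nat (card {x. f x = 0}) * (\<Sum>u\<in>range f. g u)"
proof -
  have "bij_betw (\<lambda>x. x - b) {x. f x = f b} {x. f x = 0}" for b
    by (rule bij_betwI[where g = "\<lambda>x. x + b"]) (auto simp: add diff)
  then have fibre: "card {x. f x = f b} = card {x. f x = 0}" for b
    by (rule bij_betw_same_card)
  have "(\<Sum>x\<in>UNIV. g (f x)) = (\<Sum>u\<in>range f. \<Sum>x\<in>{x. f x = u}. g (f x))"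
    using sum.image_gen[OF assms, of "\<lambda>x. g (f x)" f] by simp
  also have "\<dots> = (\<Sum>u\<in>range f. of_nat (card {x. f x = 0}) * g u)"
    by (rule sum.cong) (auto simp: fibre)
  finally show ?thesis by (simp add: sum_distrib_left)
qed

lemma (in additive) card_UNIV_eq_card_kernel_mult_card_range:
  assumes "finite (UNIV :: 'a set)"
  shows "card (UNIV :: 'a set) = card {x. f x = 0} * card (range f)"
  using sum_comp_eq_card_kernel_mult_sum_range[OF assms, of "\<lambda>_. 1 :: nat"] by simp

definition rel_trace :: "nat \<Rightarrow> nat \<Rightarrow> 'a::comm_semiring_1 \<Rightarrow> 'a" where
  "rel_trace q d x = (\<Sum>j<d. x ^ (q ^ j))"

lemma abs_trace_eq_rel_trace: "abs_trace t x = rel_trace 2 t x"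
  by (simp add: abs_trace_def rel_trace_def)

lemma rel_trace_2: "rel_trace q 2 x = x + x ^ q"
  by (simp add: rel_trace_def lessThan_nat_numeral add.commute)

lemma rel_trace_rel_trace:
  fixes x :: "'a::comm_semiring_1"
  assumes "prime CHAR('a)" and "q = CHAR('a) ^ m"
  shows "rel_trace q s (rel_trace (q ^ s) d x) = rel_trace q (d * s) x"
proof -
  have "rel_trace q s (rel_trace (q ^ s) d x) = (\<Sum>i<s. \<Sum>j<d. (x ^ ((q ^ s) ^ j)) ^ (q ^ i))"
    unfolding rel_trace_def assms(2)
    by (intro sum.cong refl freshmans_dream_sum' assms(1)) (simp flip: power_mult)
  also have "\<dots> = (\<Sum>j<d. \<Sum>i<s. x ^ (q ^ (j * s + i)))"
    by (subst sum.swap) (simp add: power_add mult.commute flip: power_mult)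
  also have "\<dots> = (\<Sum>j<d. \<Sum>i\<in>{j * s..<j * s + s}. x ^ (q ^ i))"
    by (simp add: sum.atLeastLessThan_shift_0 atLeast0LessThan)
  also have "\<dots> = rel_trace q (d * s) x"
    by (simp add: rel_trace_def sum.nat_group)
  finally show ?thesis .
qed

lemma additive_rel_trace:
  assumes "prime CHAR('a::comm_ring_1)" and "q = CHAR('a) ^ m"
  shows "additive (rel_trace q d :: 'a \<Rightarrow> 'a)"
proof
  fix x y :: 'a
  have "(x + y) ^ (q ^ j) = x ^ (q ^ j) + y ^ (q ^ j)" for j
    using assms by (intro freshmans_dream') (simp_all flip: power_mult)
  then show "rel_trace q d (x + y) = rel_trace q d x + rel_trace q d y"
    by (simp add: rel_trace_def sum.distrib)
qed

lemma rel_trace_power_CHAR: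
  fixes x :: "'a::comm_semiring_1"
  assumes "prime CHAR('a)"
  shows "rel_trace q d (x ^ (CHAR('a) ^ i)) = rel_trace q d x ^ (CHAR('a) ^ i)"
  unfolding rel_trace_def freshmans_dream_sum'[OF assms refl]
  by (simp add: mult.commute flip: power_mult)

lemma rel_trace_mult_left:
  fixes c x :: "'a::comm_semiring_1"
  assumes "c ^ q = c"
  shows "rel_trace q d (c * x) = c * rel_trace q d x"
proof -
  have "c ^ (q ^ j) = c" for j
    by (induction j) (simp_all add: assms power_mult)
  then show ?thesis
    by (simp add: rel_trace_def power_mult_distrib sum_distrib_left)
qed

lemma power_rel_trace_eq_self:
  fixes x :: "'a::comm_ring_1"
  assumes "prime CHAR('a)" and "q = CHAR('a) ^ m" and "x ^ (q ^ d) = x"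
  shows "rel_trace q d x ^ q = rel_trace q d x"
proof -
  have "rel_trace q d x ^ q = rel_trace q d (x ^ q)"
    using rel_trace_power_CHAR[OF assms(1)] assms(2) by metis
  also have "\<dots> = (\<Sum>j<d. x ^ (q ^ Suc j))"
    by (simp add: rel_trace_def flip: power_mult)
  also have "\<dots> = rel_trace q d x + (x ^ (q ^ d) - x)"
    using sum.lessThan_Suc_shift[of "\<lambda>j. x ^ (q ^ j)" d]
    by (simp add: rel_trace_def algebra_simps)
  finally show ?thesis
    using assms(3) by simp
qed

lemma card_rel_trace_kernel_le:
  assumes "q > 1" and "d > 0"
  shows "card {x :: 'a::idom. rel_trace q d x = 0} \<le> q ^ (d - 1)"
proof -
  define p :: "'a poly" where "p = (\<Sum>j<d. Polynomial.monom 1 (q ^ j))"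
  have "poly.coeff p (q ^ (d - 1)) = (\<Sum>j<d. if j = d - 1 then 1 else 0)"
    using assms(1) by (simp add: p_def coeff_sum)
  also have "\<dots> = 1"
    using assms(2) by simp
  finally have "p \<noteq> 0" by auto
  then have "card {x. poly p x = 0} \<le> degree p"
    by (rule card_poly_roots_bound)
  also have "\<dots> \<le> q ^ (d - 1)"
    unfolding p_def using assms(1)
    by (intro degree_sum_le order.trans[OF degree_monom_le] power_increasing) auto
  finally show ?thesis
    by (simp add: p_def rel_trace_def poly_sum poly_monom)
qed

lemma
  fixes q d m :: nat
  assumes "prime CHAR('a::field)" and "q = CHAR('a) ^ m" and "m > 0" and "d > 0"
    and "card (UNIV :: 'a set) = q ^ d"
  shows range_rel_trace: "range (rel_trace q d :: 'a \<Rightarrow> 'a) = {u. u ^ q = u}"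
    and card_rel_trace_kernel: "card {x :: 'a. rel_trace q d x = 0} = q ^ (d - 1)"
proof -
  let ?T = "rel_trace q d :: 'a \<Rightarrow> 'a" and ?F = "{u :: 'a. u ^ q = u}"
  have "q > 1"
    unfolding assms(2) using assms(1,3) by (intro one_less_power prime_gt_1_nat)
  have finite: "finite (UNIV :: 'a set)"
    using assms(5) \<open>q > 1\<close> by (intro card_ge_0_finite) simp
  have card_product: "card {x. ?T x = 0} * card (range ?T) = q ^ (d - 1) * q"
    using additive.card_UNIV_eq_card_kernel_mult_card_range[OF additive_rel_trace finite] assms
    by (metis power_minus_mult)
  have kernel: "card {x. ?T x = 0} \<le> q ^ (d - 1)"
    using \<open>q > 1\<close> assms(4) by (rule card_rel_trace_kernel_le)
  have fixed: "finite ?F" "card ?F \<le> q"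
    using \<open>q > 1\<close> by (rule finite_power_eq_self card_power_eq_self_le)+
  have subset: "range ?T \<subseteq> ?F"
    using power_rel_trace_eq_self[OF assms(1,2)] power_card_UNIV_eq_self[OF finite] assms(5) by auto
  have "q ^ (d - 1) * q \<le> q ^ (d - 1) * card (range ?T)"
    using card_product kernel by (metis mult_le_mono1)
  then have "q \<le> card (range ?T)"
    using \<open>q > 1\<close> by simp
  with fixed(2) have "card ?F \<le> card (range ?T)"
    by (rule order.trans)
  then show "range ?T = ?F"
    by (rule card_seteq[OF fixed(1) subset])
  then have "card (range ?T) = q"
    using \<open>q \<le> card (range ?T)\<close> fixed(2) by simp
  then show "card {x. ?T x = 0} = q ^ (d - 1)"
    using card_product \<open>q > 1\<close> by simp
qed

lemma poly_linearized_poly: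
  "poly (linearized_poly k \<alpha> a) x = (\<Sum>i=0..k. \<alpha> i * x ^ (2 ^ a i))"
  by (simp add: linearized_poly_def poly_sum poly_monom)

lemma rel_trace_poly_linearized_poly:
  fixes x :: "'a::field"
  assumes "CHAR('a) = 2" and "q = 2 ^ m" and "\<And>i. i \<le> k \<Longrightarrow> \<alpha> i ^ q = \<alpha> i"
  shows "rel_trace q d (poly (linearized_poly k \<alpha> a) x) =
    poly (linearized_poly k \<alpha> a) (rel_trace q d x)"
proof -
  interpret additive "rel_trace q d :: 'a \<Rightarrow> 'a"
    using assms(1,2) by (intro additive_rel_trace) simp_all
  show ?thesis
    using rel_trace_power_CHAR[where 'a = 'a] assms(1,3)
    by (simp add: poly_linearized_poly sum rel_trace_mult_left)
qed

lemma chi_rel_trace: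
  fixes x :: "'a::field"
  assumes "CHAR('a) = 2"
  shows "chi m (rel_trace (2 ^ m) d x) = chi (d * m) x"
proof -
  have "abs_trace m (rel_trace (2 ^ m) d x) = abs_trace (d * m) x"
    unfolding abs_trace_eq_rel_trace
    by (rule rel_trace_rel_trace[where m = 1]) (simp_all add: assms)
  then show ?thesis
    by (simp only: chi_def)
qed

lemma chi_rel_trace_mult_linearized_poly:
  fixes x :: "'a::field"
  assumes "CHAR('a) = 2" and "x ^ (2 ^ (d * m)) = x"
    and "\<And>i. i \<le> k \<Longrightarrow> \<alpha> i ^ (2 ^ m) = \<alpha> i"
    and "L = linearized_poly k \<alpha> a" and "u = rel_trace (2 ^ m) d x"
  shows "chi (d * m) (u * poly L x) = chi m (u * poly L u)"
proof -
  have "u ^ (2 ^ m) = u"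
    unfolding assms(5)
    by (rule power_rel_trace_eq_self[where m = m])
      (simp_all add: assms(1,2) mult.commute flip: power_mult)
  have "rel_trace (2 ^ m) d (u * poly L x) = u * rel_trace (2 ^ m) d (poly L x)"
    using \<open>u ^ (2 ^ m) = u\<close> by (rule rel_trace_mult_left)
  also have "\<dots> = u * poly L u"
    using assms(1,3) by (simp add: assms(4,5) rel_trace_poly_linearized_poly)
  finally show ?thesis
    using chi_rel_trace[OF assms(1), of m d "u * poly L x"] by simp
qed

lemma sum_chi_rel_trace_mult_linearized_poly:
  assumes "card (UNIV :: 'a::field set) = 2 ^ (d * m)" and "m > 0" and "d > 0"
    and "\<And>i. i \<le> k \<Longrightarrow> \<alpha> i ^ (2 ^ m) = \<alpha> i"
    and "L = linearized_poly k \<alpha> a"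
  shows "(\<Sum>x\<in>UNIV. chi (d * m) (rel_trace (2 ^ m) d x * poly L x)) =
    2 ^ (m * (d - 1)) * (\<Sum>u | u ^ (2 ^ m) = (u :: 'a). chi m (u * poly L u))"
proof -
  let ?T = "rel_trace (2 ^ m) d :: 'a \<Rightarrow> 'a"
  have CHAR: "CHAR('a) = 2"
    using two_is_prime_nat assms(1) by (rule CHAR_eq_if_card_UNIV_eq_prime_power)
  have CHAR_power: "prime CHAR('a)" "2 ^ m = CHAR('a) ^ m"
    by (simp_all add: CHAR)
  have card: "card (UNIV :: 'a set) = (2 ^ m) ^ d"
    by (simp add: assms(1) mult.commute flip: power_mult)
  have finite: "finite (UNIV :: 'a set)"
    using assms(1) by (intro card_ge_0_finite) simp
  have "x ^ (2 ^ (d * m)) = x" for x :: 'a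
    using power_card_UNIV_eq_self[OF finite, of x] assms(1) by simp
  then have "(\<Sum>x\<in>UNIV. chi (d * m) (?T x * poly L x)) =
      (\<Sum>x\<in>UNIV. chi m (?T x * poly L (?T x)))"
    by (intro sum.cong refl chi_rel_trace_mult_linearized_poly[OF CHAR _ assms(4,5)])
  also have "\<dots> = of_nat (card {x. ?T x = 0}) * (\<Sum>u\<in>range ?T. chi m (u * poly L u))"
    using additive_rel_trace[OF CHAR_power] finite
    by (rule additive.sum_comp_eq_card_kernel_mult_sum_range)
  also have "\<dots> = of_nat ((2 ^ m) ^ (d - 1)) * (\<Sum>u | u ^ (2 ^ m) = u. chi m (u * poly L u))"
    by (simp only: range_rel_trace[OF CHAR_power assms(2,3) card]
        card_rel_trace_kernel[OF CHAR_power assms(2,3) card])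
  finally show ?thesis
    by (simp add: power_mult)
qed

theorem theorem3:
  fixes m n k :: nat
    and K :: "'a::field set"
    and \<alpha> :: "nat \<Rightarrow> 'a"
    and a :: "nat \<Rightarrow> nat"
    and L :: "'a poly"
  assumes "m \<ge> 1" and "n = 2 * m"
    and "card (UNIV :: 'a set) = 2 ^ n"
    and "subfield K (ring_of_type_algebra :: 'a ring)" and "card K = 2 ^ m"
    and "\<And>i. i \<le> k \<Longrightarrow> \<alpha> i \<in> K"
    and "L = linearized_poly k \<alpha> a"
  shows "r_sum m L = 2 ^ m * (\<Sum>u\<in>K. chi m (u * poly L u))
    \<and> 2 ^ m * (\<Sum>u\<in>K. chi m (u * poly L u))
      = 2 ^ m * (\<Sum>u\<in>K. chi m (\<Sum>i=0..k. \<alpha> i * u ^ (2 ^ a i + 1)))"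
proof
  have "finite K"
    using assms(5) by (intro card_ge_0_finite) simp
  then have fixed_points: "K = {x. x ^ (2 ^ m) = x}"
    unfolding assms(5)[symmetric] by (rule subfield_eq_fixed_points_power_card[OF assms(4)])
  have coeffs: "\<alpha> i ^ (2 ^ m) = \<alpha> i" if "i \<le> k" for i
    using assms(6)[OF that] by (subst (asm) fixed_points) simp
  have "r_sum m L = (\<Sum>x\<in>UNIV. chi (2 * m) (rel_trace (2 ^ m) 2 x * poly L x))"
    by (simp add: r_sum_def rel_trace_2 add.commute)
  also have "\<dots> = 2 ^ m * (\<Sum>u\<in>K. chi m (u * poly L u))"
    using sum_chi_rel_trace_mult_linearized_poly[OF _ _ _ coeffs assms(7), of 2] assms(1-3)
    by (simp flip: fixed_points)
  finally show "r_sum m L = 2 ^ m * (\<Sum>u\<in>K. chi m (u * poly L u))" .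
  show "2 ^ m * (\<Sum>u\<in>K. chi m (u * poly L u))
      = 2 ^ m * (\<Sum>u\<in>K. chi m (\<Sum>i=0..k. \<alpha> i * u ^ (2 ^ a i + 1)))"
    by (simp add: assms(7) poly_linearized_poly sum_distrib_left mult.left_commute)
qed

end
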